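(* For all integers $n\ge k\ge r\ge 1$, $$S^B_{n,k,r}=S^B_{n,k,r-1}-(2r-1)\,S^B_{n-1,k,r-1}.$$
   Context: A set partition of $[\pm n]=\{\pm1,\dots,\pm n\}$ of type $B$ is a set partition of $[\pm n]$ such that (i) if $B$ is a block then $-B=\{-b: b\in B\}$ is also a block, and (ii) there is at most one block with $B=-B$ (called the zero block). The non-zero blocks come in pairs $\{B,-B\}$, and each pair is counted as one (representative) non-zero block. For integers $n,k,r\ge0$, $S^B_{n,k,r}$ (the $r$-Stirling number of type $B$ of the second kind) is the number of set partitions of $[\pm n]$ of type $B$ with exactly $k$ (representative) non-zero blocks in which none of $1,\dots,r$ lies in the zero block and $1,\dots,r$ lie in pairwise distinct pairs $\{B,-B\}$. If $n<r$ then $S^B_{n,k,r}=0$. *)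

theory Defs
  imports Main "HOL-Library.Disjoint_Sets"
begin

definition pm_set :: "nat \<Rightarrow> int set" where
  "pm_set n = {- int n..int n} - {0}"

definition type_B_partition :: "nat \<Rightarrow> int set set \<Rightarrow> bool" where
  "type_B_partition n P \<longleftrightarrow>
     partition_on (pm_set n) P \<and>
     (\<forall>B\<in>P. uminus ` B \<in> P) \<and>
     (\<exists>\<^sub>\<le>\<^sub>1 B. B \<in> P \<and> uminus ` B = B)"

definition nonzero_pairs :: "int set set \<Rightarrow> int set set set" where
  "nonzero_pairs P = {{B, uminus ` B} |B. B \<in> P \<and> uminus ` B \<noteq> B}"

definition r_separated :: "nat \<Rightarrow> int set set \<Rightarrow> bool" where
  "r_separated r P \<longleftrightarrow>
     (\<forall>i\<in>{1..int r}. \<forall>B\<in>P. i \<in> B \<longrightarrow> uminus ` B \<noteq> B) \<and>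
     (\<forall>i\<in>{1..int r}. \<forall>j\<in>{1..int r}. \<forall>B\<in>P. \<forall>C\<in>P.
        i \<noteq> j \<longrightarrow> i \<in> B \<longrightarrow> j \<in> C \<longrightarrow> {B, uminus ` B} \<noteq> {C, uminus ` C})"

(* The case n < r is a separate convention: r_separated r P says nothing about
   elements of {1..r} that are not in [+-n]. *)
definition stirling_B :: "nat \<Rightarrow> nat \<Rightarrow> nat \<Rightarrow> nat" where
  "stirling_B n k r =
     (if n < r then 0
      else card {P. type_B_partition n P \<and> card (nonzero_pairs P) = k \<and> r_separated r P})"

end

theory Submission
  imports Defs
begin

text \<open>
  Put 0 into the zero block, creating the block \<open>{0}\<close> if there is no zero block. A type B partition of
  \<open>[\<plusminus>n]\<close> becomes a partition of \<open>{-n..n}\<close> that is closed under negation and whose only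
  self-opposite block is the one containing 0. All conditions become uniform: \<open>k\<close> pairs of nonzero
  blocks means \<open>2k + 1\<close> blocks, and the condition on \<open>1, \<dots>, r\<close> says that the \<open>2r + 1\<close> integers
  \<open>-r, \<dots>, r\<close> lie in pairwise different blocks. For if \<open>i\<close> shares a block with 0, then so does
  \<open>-i\<close>, and a block that contains both \<open>i\<close> and \<open>-i\<close> is self-opposite, hence contains 0.
  This translation is \<open>stirling_B_eq_card_signed_partitions\<close>.

  Now take a partition in which \<open>-(r-1), \<dots>, r-1\<close> lie in different blocks. Either \<open>-r, \<dots>, r\<close> do so
  too, or \<open>r\<close> shares its block with one of the \<open>2r - 1\<close> integers \<open>c\<close> with \<open>\<bar>c\<bar> < r\<close>
  (\<open>separates_step\<close>), and \<open>c\<close> is then unique because these integers are separated. For a fixed \<open>c\<close>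
  the position of \<open>\<plusminus>r\<close> carries no information: deleting \<open>\<plusminus>r\<close> and closing the gap is a bijection
  onto the partitions of \<open>{-(n-1)..n-1}\<close> with the same number of blocks in which
  \<open>-(r-1), \<dots>, r-1\<close> are separated (\<open>card_signed_partitions_glued\<close>). Summing over \<open>c\<close> gives the
  recurrence.
\<close>

section \<open>Blocks and negation\<close>

lemma mem_uminus_image: "(x::int) \<in> uminus ` B \<longleftrightarrow> - x \<in> B"
  by force

lemma uminus_image_twice: "uminus ` (uminus ` B) = (B :: int set)"
  by (simp add: image_image)

lemma partition_on_block_unique:
  assumes "partition_on A P" "B \<in> P" "C \<in> P" "x \<in> B" "x \<in> C"
  shows "B = C"
  using assms unfolding partition_on_def disjoint_def by blast

section \<open>Adjoining 0 to the zero block\<close>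

definition signed_partition :: "nat \<Rightarrow> int set set \<Rightarrow> bool" where
  "signed_partition n Q \<longleftrightarrow>
     partition_on {- int n..int n} Q \<and>
     (\<forall>B\<in>Q. uminus ` B \<in> Q) \<and>
     (\<forall>B\<in>Q. uminus ` B = B \<longrightarrow> 0 \<in> B)"

text \<open>
  The bound is on absolute values, so 0 and the negatives are separated as well; this encodes both
  halves of the condition on \<open>1, \<dots>, s\<close> at once.
\<close>

definition separates :: "nat \<Rightarrow> int set set \<Rightarrow> bool" where
  "separates s Q \<longleftrightarrow> (\<forall>B\<in>Q. \<forall>x\<in>B. \<forall>y\<in>B. \<bar>x\<bar> \<le> int s \<longrightarrow> \<bar>y\<bar> \<le> int s \<longrightarrow> x = y)"

lemma separatesD:
  assumes "separates s Q" "B \<in> Q" "x \<in> B" "y \<in> B" "\<bar>x\<bar> \<le> int s" "\<bar>y\<bar> \<le> int s"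
  shows "x = y"
  using assms unfolding separates_def by blast

definition signed_partitions :: "nat \<Rightarrow> nat \<Rightarrow> nat \<Rightarrow> int set set set" where
  "signed_partitions n k s = {Q. signed_partition n Q \<and> card Q = 2 * k + 1 \<and> separates s Q}"

text \<open>
  A type B partition has at most one self-opposite block, so the union below is the zero block if
  there is one and empty otherwise; in the latter case the new block is \<open>{0}\<close>.
\<close>

definition adjoin_zero :: "int set set \<Rightarrow> int set set" where
  "adjoin_zero P = insert (insert 0 (\<Union>{B\<in>P. uminus ` B = B})) {B\<in>P. uminus ` B \<noteq> B}"

text \<open>
  The empty set is discarded because deleting 0 from the block \<open>{0}\<close> must leave no zero block at all.
\<close>

definition delete_zero :: "int set set \<Rightarrow> int set set" where
  "delete_zero Q = (\<lambda>B. B - {0}) ` Q - {{}}"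

lemma pm_set_omits_zero: "0 \<notin> pm_set n" "insert 0 (pm_set n) = {- int n..int n}"
  by (auto simp: pm_set_def)

lemma type_B_partition_zero_cases:
  assumes "type_B_partition n P"
  obtains "{B\<in>P. uminus ` B = B} = {}" | Z where "{B\<in>P. uminus ` B = B} = {Z}" "Z \<in> P" "uminus ` Z = Z"
proof (cases "{B\<in>P. uminus ` B = B} = {}")
  case False
  then obtain Z where Z: "Z \<in> P" "uminus ` Z = Z" by blast
  have "B = Z" if "B \<in> P" "uminus ` B = B" for B
    using assms that Z unfolding type_B_partition_def Uniq_def by blast
  then have "{B\<in>P. uminus ` B = B} = {Z}" using Z by blast
  then show ?thesis using Z that by blast
qed (use that in blast)

lemma signed_partition_adjoin_zero:
  assumes P: "type_B_partition n P"
  shows "signed_partition n (adjoin_zero P)"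
proof -
  have part: "partition_on (pm_set n) P" and sym: "\<And>B. B \<in> P \<Longrightarrow> uminus ` B \<in> P"
    using P by (auto simp: type_B_partition_def)
  have z: "0 \<notin> B" if "B \<in> P" for B
    using part that pm_set_omits_zero(1) unfolding partition_on_def by blast
  let ?Z = "insert 0 (\<Union>{B\<in>P. uminus ` B = B})"
  have "partition_on {- int n..int n} (adjoin_zero P)"
  proof (rule partition_onI)
    show "\<Union>(adjoin_zero P) = {- int n..int n}"
    proof -
      have "\<Union>(adjoin_zero P) = insert 0 (\<Union>P)" unfolding adjoin_zero_def by blast
      also have "\<Union>P = pm_set n" using part by (simp add: partition_on_def)
      finally show ?thesis by (simp only: pm_set_omits_zero(2))
    qed
    show "{} \<notin> adjoin_zero P"
      using part unfolding adjoin_zero_def partition_on_def by auto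
    show "disjnt p p'" if "p \<in> adjoin_zero P" "p' \<in> adjoin_zero P" "p \<noteq> p'" for p p'
    proof -
      \<comment> \<open>A nonzero point determines its new block through the block of \<open>P\<close> that contains it.\<close>
      have home: "p = (if uminus ` B = B then ?Z else B)"
        if p: "p \<in> adjoin_zero P" "x \<in> p" and B: "B \<in> P" "x \<in> B" for p x B
      proof (cases "p = ?Z")
        case True
        moreover have "x \<noteq> 0" using z[OF B(1)] B(2) by blast
        ultimately obtain C where "C \<in> P" "uminus ` C = C" "x \<in> C" using p(2) by blast
        then show ?thesis using partition_on_block_unique[OF part, of C B x] B True by simp
      next
        case False
        then have "p \<in> P" "uminus ` p \<noteq> p" using p(1) unfolding adjoin_zero_def by auto
        then show ?thesis using partition_on_block_unique[OF part, of p B x] p B by simp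
      qed
      have at_zero: "p = ?Z" if "p \<in> adjoin_zero P" "0 \<in> p" for p
        using that z unfolding adjoin_zero_def by blast
      have "p = p'" if x: "x \<in> p" "x \<in> p'" for x
      proof (cases "x = 0")
        case True
        then show ?thesis using at_zero that \<open>p \<in> _\<close> \<open>p' \<in> _\<close> by blast
      next
        case False
        then obtain B where "B \<in> P" "x \<in> B"
          using x(1) \<open>p \<in> _\<close> unfolding adjoin_zero_def by blast
        then show ?thesis
          using home[OF \<open>p \<in> _\<close> x(1)] home[OF \<open>p' \<in> _\<close> x(2)] by simp
      qed
      then show ?thesis using \<open>p \<noteq> p'\<close> by (auto simp: disjnt_def)
    qed
  qed
  moreover have "uminus ` B \<in> adjoin_zero P" if "B \<in> adjoin_zero P" for B
  proof -
    have "uminus ` ?Z = ?Z"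
      by (rule type_B_partition_zero_cases[OF P])
        (simp_all only: Union_empty Union_insert Un_empty_right image_insert image_empty minus_zero)
    with that sym show ?thesis
      unfolding adjoin_zero_def using uminus_image_twice by auto
  qed
  moreover have "0 \<in> B" if "B \<in> adjoin_zero P" "uminus ` B = B" for B
    using that unfolding adjoin_zero_def by blast
  ultimately show ?thesis unfolding signed_partition_def by blast
qed

lemma delete_adjoin_zero:
  assumes P: "type_B_partition n P"
  shows "delete_zero (adjoin_zero P) = P"
proof -
  have part: "partition_on (pm_set n) P"
    using P by (auto simp: type_B_partition_def)
  have z: "0 \<notin> B" "B \<noteq> {}" if "B \<in> P" for B
    using part that pm_set_omits_zero(1) unfolding partition_on_def by blast+
  have "(\<lambda>B. B - {0}) ` {B \<in> P. uminus ` B \<noteq> B} = {B \<in> P. uminus ` B \<noteq> B}"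
    using z(1) by force
  moreover have "insert (\<Union>{B\<in>P. uminus ` B = B}) {B \<in> P. uminus ` B \<noteq> B} - {{}} = P"
    using z(2) by (rule_tac type_B_partition_zero_cases[OF P]) (simp_all, blast+)
  moreover have "insert 0 (\<Union>{B\<in>P. uminus ` B = B}) - {0} = \<Union>{B\<in>P. uminus ` B = B}"
    using z(1) by blast
  ultimately show ?thesis unfolding delete_zero_def adjoin_zero_def by simp
qed

text \<open>
  The block of 0 meets its opposite in 0, so it is self-opposite, and no other block is.
\<close>

lemma signed_partition_zero_block:
  assumes "signed_partition n Q"
  obtains Z where "Z \<in> Q" "0 \<in> Z" "uminus ` Z = Z"
    "\<And>B. B \<in> Q \<Longrightarrow> B \<noteq> Z \<Longrightarrow> 0 \<notin> B" "\<And>B. B \<in> Q \<Longrightarrow> B \<noteq> Z \<Longrightarrow> uminus ` B \<noteq> B"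
proof -
  have part: "partition_on {- int n..int n} Q" and sym: "\<And>B. B \<in> Q \<Longrightarrow> uminus ` B \<in> Q"
    and self: "\<And>B. B \<in> Q \<Longrightarrow> uminus ` B = B \<Longrightarrow> 0 \<in> B"
    using assms by (auto simp: signed_partition_def)
  have "(0::int) \<in> {- int n..int n}" by simp
  then obtain Z where Z: "Z \<in> Q" "0 \<in> Z"
    using part unfolding partition_on_def by blast
  have "0 \<in> uminus ` Z" using Z(2) by (simp add: mem_uminus_image)
  then have symZ: "uminus ` Z = Z"
    by (rule partition_on_block_unique[OF part sym[OF Z(1)] Z(1) _ Z(2)])
  have nz: "0 \<notin> B" if "B \<in> Q" "B \<noteq> Z" for B
    using partition_on_block_unique[OF part that(1) Z(1) _ Z(2)] that(2) by blast
  have "uminus ` B \<noteq> B" if "B \<in> Q" "B \<noteq> Z" for B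
    using nz[OF that] self[OF that(1)] by metis
  then show ?thesis using that[OF Z symZ nz] by metis
qed

lemma adjoin_delete_zero:
  assumes Q: "signed_partition n Q"
  shows "type_B_partition n (delete_zero Q)" "adjoin_zero (delete_zero Q) = Q"
proof -
  have part: "partition_on {- int n..int n} Q" and sym: "\<And>B. B \<in> Q \<Longrightarrow> uminus ` B \<in> Q"
    using Q by (auto simp: signed_partition_def)
  obtain Z where Z: "Z \<in> Q" "0 \<in> Z" "uminus ` Z = Z"
    and nz: "\<And>B. B \<in> Q \<Longrightarrow> B \<noteq> Z \<Longrightarrow> 0 \<notin> B"
    and ns: "\<And>B. B \<in> Q \<Longrightarrow> B \<noteq> Z \<Longrightarrow> uminus ` B \<noteq> B"
    using signed_partition_zero_block[OF Q] by blast
  have ne: "{} \<notin> Q" using part by (simp add: partition_on_def)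
  have "(\<lambda>B. B - {0}) ` (Q - {Z}) = Q - {Z}" using nz by force
  then have del: "delete_zero Q = (Q - {Z}) \<union> ({Z - {0}} - {{}})"
    using Z(1) ne unfolding delete_zero_def by blast
  have symZ: "uminus ` (Z - {0}) = Z - {0}"
    using Z(3) by (simp add: set_eq_iff mem_uminus_image) 
  have "partition_on (pm_set n) (delete_zero Q)"
  proof (rule partition_onI)
    show "\<Union>(delete_zero Q) = pm_set n"
    proof -
      have "\<Union>(delete_zero Q) = \<Union>Q - {0}" unfolding delete_zero_def by blast
      also have "\<Union>Q = {- int n..int n}" using part by (simp add: partition_on_def)
      finally show ?thesis by (simp only: pm_set_def)
    qed
    show "{} \<notin> delete_zero Q" by (simp add: delete_zero_def)
    show "disjnt p p'" if pp: "p \<in> delete_zero Q" "p' \<in> delete_zero Q" "p \<noteq> p'" for p p'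
    proof -
      obtain B B' where B: "B \<in> Q" "p = B - {0}" "B' \<in> Q" "p' = B' - {0}"
        using pp(1,2) unfolding delete_zero_def by blast
      then have "B \<inter> B' = {}" using pp(3) partition_on_block_unique[OF part] by blast
      then show ?thesis using B by (auto simp: disjnt_def)
    qed
  qed
  moreover have "uminus ` B \<in> delete_zero Q" if "B \<in> delete_zero Q" for B
  proof (cases "B = Z - {0}")
    case True
    then show ?thesis using that symZ by simp
  next
    case False
    with that del have "B \<in> Q" "B \<noteq> Z" by auto
    then have "uminus ` B \<in> Q" "uminus ` B \<noteq> Z"
      using sym Z(3) uminus_image_twice by metis+
    then show ?thesis using del by blast
  qed
  moreover have self: "B = Z - {0}" if "B \<in> delete_zero Q" "uminus ` B = B" for B
  proof (rule ccontr)
    assume "B \<noteq> Z - {0}"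
    then have "B \<in> Q" "B \<noteq> Z" using that(1) del by auto
    then show False using ns that(2) by blast
  qed
  moreover have "\<exists>\<^sub>\<le>\<^sub>1 B. B \<in> delete_zero Q \<and> uminus ` B = B"
    by (rule Uniq_I) (metis self)
  ultimately show "type_B_partition n (delete_zero Q)"
    unfolding type_B_partition_def by simp
  have "insert 0 (\<Union>{B\<in>delete_zero Q. uminus ` B = B}) = Z"
  proof (cases "Z - {0} = {}")
    case True
    then have "{B\<in>delete_zero Q. uminus ` B = B} = {}"
      using self by (auto simp: delete_zero_def)
    then show ?thesis using True Z(2) by auto
  next
    case False
    then have "{B\<in>delete_zero Q. uminus ` B = B} = {Z - {0}}"
    proof (intro set_eqI iffI)
      fix B assume "B \<in> {Z - {0}}"
      then show "B \<in> {B\<in>delete_zero Q. uminus ` B = B}"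
        using False symZ del by simp
    qed (use self in simp)
    then show ?thesis using Z(2) by auto
  qed
  moreover have "{B\<in>delete_zero Q. uminus ` B \<noteq> B} = Q - {Z}"
  proof (intro set_eqI iffI)
    fix B assume "B \<in> {B\<in>delete_zero Q. uminus ` B \<noteq> B}"
    then show "B \<in> Q - {Z}" using symZ unfolding del by auto
  next
    fix B assume "B \<in> Q - {Z}"
    then show "B \<in> {B\<in>delete_zero Q. uminus ` B \<noteq> B}"
      using ns[of B] unfolding del by blast
  qed
  ultimately show "adjoin_zero (delete_zero Q) = Q"
    by (simp only: adjoin_zero_def insert_Diff[OF Z(1)])
qed

text \<open>
  The nonzero blocks are the disjoint union of the two-element sets \<open>{B, -B}\<close>, and the block of 0
  adds one.
\<close>

lemma card_adjoin_zero:
  assumes P: "type_B_partition n P"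
  shows "card (adjoin_zero P) = 2 * card (nonzero_pairs P) + 1"
proof -
  let ?N = "{B\<in>P. uminus ` B \<noteq> B}"
  have part: "partition_on (pm_set n) P" and sym: "\<And>B. B \<in> P \<Longrightarrow> uminus ` B \<in> P"
    using P by (auto simp: type_B_partition_def)
  have "finite (pm_set n)" by (simp add: pm_set_def)
  then have finP: "finite P" using part by (rule finite_elements)
  have "\<Union>(nonzero_pairs P) = ?N"
  proof
    show "\<Union>(nonzero_pairs P) \<subseteq> ?N"
    proof
      fix B assume "B \<in> \<Union>(nonzero_pairs P)"
      then obtain C where "C \<in> P" "uminus ` C \<noteq> C" "B = C \<or> B = uminus ` C"
        unfolding nonzero_pairs_def by blast
      then show "B \<in> ?N" using sym uminus_image_twice[of C] by auto
    qed
    show "?N \<subseteq> \<Union>(nonzero_pairs P)" unfolding nonzero_pairs_def by blast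
  qed
  moreover have "2 * card (nonzero_pairs P) = card (\<Union>(nonzero_pairs P))"
  proof (rule card_partition)
    show fin: "finite (\<Union>(nonzero_pairs P))" using finP calculation by simp
    show "finite (nonzero_pairs P)" using fin by (rule finite_UnionD)
    show "card c = 2" if "c \<in> nonzero_pairs P" for c
      using that unfolding nonzero_pairs_def by (auto simp: card_2_iff)
    show "c1 \<inter> c2 = {}" if c: "c1 \<in> nonzero_pairs P" "c2 \<in> nonzero_pairs P" "c1 \<noteq> c2" for c1 c2
    proof -
      obtain B C where BC: "c1 = {B, uminus ` B}" "c2 = {C, uminus ` C}"
        using c(1,2) unfolding nonzero_pairs_def by blast
      then have "B \<noteq> C" "B \<noteq> uminus ` C" "uminus ` B \<noteq> C"
        using c(3) uminus_image_twice[of B] uminus_image_twice[of C] by auto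
      moreover from this have "uminus ` B \<noteq> uminus ` C"
        using uminus_image_twice[of B] uminus_image_twice[of C] by metis
      ultimately show ?thesis using BC by blast
    qed
  qed
  moreover have "insert 0 (\<Union>{B\<in>P. uminus ` B = B}) \<notin> ?N"
    using part pm_set_omits_zero(1) unfolding partition_on_def by blast
  ultimately show ?thesis unfolding adjoin_zero_def using finP by simp
qed

text \<open>
  Two different points of \<open>{-r..r}\<close> in one block are of one of three kinds: one of them is 0, and the
  other one lies in the zero block; they are opposite, and the block is self-opposite; or their absolute
  values are different elements of \<open>{1..r}\<close> that lie in the same pair \<open>{B, -B}\<close>. The two halves of
  the condition on \<open>1, \<dots>, r\<close> exclude exactly these.
\<close>

lemma separates_adjoin_zero:
  assumes P: "type_B_partition n P"
  shows "separates r (adjoin_zero P) \<longleftrightarrow> r_separated r P"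
proof
  have part: "partition_on (pm_set n) P" and sym: "\<And>B. B \<in> P \<Longrightarrow> uminus ` B \<in> P"
    using P by (auto simp: type_B_partition_def)
  have z: "0 \<notin> B" if "B \<in> P" for B
    using part that pm_set_omits_zero(1) unfolding partition_on_def by blast
  show "r_separated r P" if sep: "separates r (adjoin_zero P)"
  proof -
    have nonzero: "uminus ` B \<noteq> B" if "i \<in> {1..int r}" "B \<in> P" "i \<in> B" for i B
    proof
      assume "uminus ` B = B"
      then have "i \<in> insert 0 (\<Union>{B\<in>P. uminus ` B = B})" using that by blast
      then have "i = 0"
        using separatesD[OF sep, of "insert 0 (\<Union>{B\<in>P. uminus ` B = B})" i 0] that(1)
        unfolding adjoin_zero_def by simp
      then show False using that(1) by simp
    qed
    have pairs: "{B, uminus ` B} \<noteq> {C, uminus ` C}"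
      if "i \<in> {1..int r}" "j \<in> {1..int r}" "B \<in> P" "C \<in> P" "i \<noteq> j" "i \<in> B" "j \<in> C" for i j B C
    proof
      assume "{B, uminus ` B} = {C, uminus ` C}"
      then have "C = B \<or> C = uminus ` B" by (simp add: doubleton_eq_iff) metis
      then have "j \<in> B \<or> - j \<in> B" using \<open>j \<in> C\<close> by (auto simp: mem_uminus_image)
      moreover have "B \<in> adjoin_zero P" using nonzero that unfolding adjoin_zero_def by blast
      ultimately have "i = j \<or> i = - j"
        using separatesD[OF sep, of B i j] separatesD[OF sep, of B i "- j"] that by auto
      then show False using that by auto
    qed
    show ?thesis
      unfolding r_separated_def
      by (intro conjI ballI impI; (rule nonzero | rule pairs); assumption)
  qed
  show "separates r (adjoin_zero P)" if sep: "r_separated r P"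
  proof -
    \<comment> \<open>Replacing a point by its absolute value stays within the pair of opposite blocks.\<close>
    have abs: "\<exists>C\<in>P. \<bar>x\<bar> \<in> C \<and> {C, uminus ` C} = {B, uminus ` B}" if "B \<in> P" "x \<in> B" for x B
    proof (cases "x \<ge> 0")
      case False
      then have "\<bar>x\<bar> \<in> uminus ` B" using that by auto
      moreover have "{uminus ` B, uminus ` (uminus ` B)} = {B, uminus ` B}"
        by (simp only: uminus_image_twice insert_commute)
      ultimately show ?thesis using sym[OF that(1)] by (rule_tac bexI[of _ "uminus ` B"]) simp_all
    qed (use that in auto)
    have nonzero: "uminus ` B \<noteq> B" if xB: "B \<in> P" "x \<in> B" "\<bar>x\<bar> \<le> int r" for x B
    proof
      assume "uminus ` B = B"
      then have "\<bar>x\<bar> \<in> B" using abs[OF xB(1,2)] by auto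
      moreover have "x \<noteq> 0" using z[OF xB(1)] xB(2) by blast
      then have "\<bar>x\<bar> \<in> {1..int r}" using xB(3) by simp
      ultimately show False
        using sep xB(1) \<open>uminus ` B = B\<close> unfolding r_separated_def by simp
    qed
    have "x = y" if B: "B \<in> adjoin_zero P" "x \<in> B" "y \<in> B" and xy: "\<bar>x\<bar> \<le> int r" "\<bar>y\<bar> \<le> int r" for B x y
    proof (cases "B \<in> P")
      case False
      then have "B = insert 0 (\<Union>{B\<in>P. uminus ` B = B})"
        using B(1) unfolding adjoin_zero_def by simp
      then have "w = 0" if "w \<in> B" "\<bar>w\<bar> \<le> int r" for w
        using that nonzero by blast
      then show ?thesis using B xy by blast
    next
      case True
      have "x \<noteq> 0" "y \<noteq> 0" using z True B by auto
      have "\<bar>x\<bar> = \<bar>y\<bar>"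
      proof (rule ccontr)
        assume "\<bar>x\<bar> \<noteq> \<bar>y\<bar>"
        moreover have "\<bar>x\<bar> \<in> {1..int r}" "\<bar>y\<bar> \<in> {1..int r}" using \<open>x \<noteq> 0\<close> \<open>y \<noteq> 0\<close> xy by auto
        ultimately show False
          using sep abs[OF True B(2)] abs[OF True B(3)] unfolding r_separated_def by metis
      qed
      moreover have "y \<noteq> - x"
      proof
        assume "y = - x"
        then have "x \<in> uminus ` B" using B by (simp add: mem_uminus_image)
        then have "uminus ` B = B"
          using partition_on_block_unique[OF part sym[OF True] True, of x] B by simp
        then show False using nonzero[OF True B(2) xy(1)] by simp
      qed
      ultimately show ?thesis by linarith
    qed
    then show ?thesis unfolding separates_def by blast
  qed
qed

lemma stirling_B_eq_card_signed_partitions: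
  assumes "r \<le> n"
  shows "stirling_B n k r = card (signed_partitions n k r)"
proof -
  have "bij_betw adjoin_zero
      {P. type_B_partition n P \<and> card (nonzero_pairs P) = k \<and> r_separated r P}
      (signed_partitions n k r)"
  proof (rule bij_betwI)
    show "adjoin_zero \<in> {P. type_B_partition n P \<and> card (nonzero_pairs P) = k \<and> r_separated r P}
        \<rightarrow> signed_partitions n k r"
      using signed_partition_adjoin_zero card_adjoin_zero separates_adjoin_zero
      by (auto simp: signed_partitions_def)
    show "delete_zero \<in> signed_partitions n k r
        \<rightarrow> {P. type_B_partition n P \<and> card (nonzero_pairs P) = k \<and> r_separated r P}"
    proof
      fix Q assume "Q \<in> signed_partitions n k r"
      then have Q: "signed_partition n Q" "card Q = 2 * k + 1" "separates r Q"
        by (auto simp: signed_partitions_def)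
      note del = adjoin_delete_zero[OF Q(1)]
      show "delete_zero Q \<in> {P. type_B_partition n P \<and> card (nonzero_pairs P) = k \<and> r_separated r P}"
        using del(1) card_adjoin_zero[OF del(1)] separates_adjoin_zero[OF del(1)] Q(2,3)
        unfolding del(2) by simp
    qed
  qed (auto simp: delete_adjoin_zero adjoin_delete_zero signed_partitions_def)
  then show ?thesis using assms by (simp add: stirling_B_def bij_betw_same_card)
qed

section \<open>Pulling partitions back along odd maps\<close>

text \<open>
  Both directions of the bijection that removes or inserts \<open>\<plusminus>r\<close> are of this form, so that the
  transfer of all properties is proved only once.
\<close>

definition pullback :: "nat \<Rightarrow> (int \<Rightarrow> int) \<Rightarrow> int set set \<Rightarrow> int set set" where
  "pullback m g Q = (\<lambda>B. {x \<in> {- int m..int m}. g x \<in> B}) ` Q"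

text \<open>
  If \<open>g\<close> meets every block, then the preimages are nonempty and different blocks have different
  preimages, so the number of blocks is kept. Since \<open>g\<close> is odd, taking preimages commutes with
  negation, and \<open>g 0 = 0\<close>; hence a self-opposite preimage comes from the block of 0 and contains 0.
\<close>

lemma signed_partition_pullback:
  assumes Q: "signed_partition n Q"
    and range: "\<And>x. x \<in> {- int m..int m} \<Longrightarrow> g x \<in> {- int n..int n}"
    and odd: "\<And>x. g (- x) = - g x"
    and hit: "\<And>B. B \<in> Q \<Longrightarrow> \<exists>x \<in> {- int m..int m}. g x \<in> B"
  shows "signed_partition m (pullback m g Q)" "card (pullback m g Q) = card Q"
proof -
  let ?h = "\<lambda>B. {x \<in> {- int m..int m}. g x \<in> B}"
  have part: "partition_on {- int n..int n} Q" and sym: "\<And>B. B \<in> Q \<Longrightarrow> uminus ` B \<in> Q"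
    using Q by (auto simp: signed_partition_def)
  have eq: "B = C" if "B \<in> Q" "C \<in> Q" "x \<in> ?h B" "x \<in> ?h C" for B C x
    using partition_on_block_unique[OF part that(1,2)] that(3,4) by blast
  have inj: "inj_on ?h Q"
  proof (rule inj_onI)
    fix B C assume BC: "B \<in> Q" "C \<in> Q" "?h B = ?h C"
    then obtain x where "x \<in> ?h B" using hit by blast
    then show "B = C" using eq BC by blast
  qed
  then show "card (pullback m g Q) = card Q"
    unfolding pullback_def by (rule card_image)
  have neg: "uminus ` ?h B = ?h (uminus ` B)" for B
    by (auto simp: set_eq_iff mem_uminus_image odd)
  have g0: "g 0 = 0" using odd[of 0] by simp
  have "partition_on {- int m..int m} (pullback m g Q)"
  proof (rule partition_onI)
    have "\<Union>Q = {- int n..int n}" using part by (simp add: partition_on_def)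
    then show "\<Union>(pullback m g Q) = {- int m..int m}"
      using range unfolding pullback_def by blast
    show "{} \<notin> pullback m g Q" using hit unfolding pullback_def by blast
    show "disjnt p p'" if "p \<in> pullback m g Q" "p' \<in> pullback m g Q" "p \<noteq> p'" for p p'
      using that eq unfolding pullback_def disjnt_def by blast
  qed
  moreover have "uminus ` B \<in> pullback m g Q" if B: "B \<in> pullback m g Q" for B
  proof -
    obtain C where C: "C \<in> Q" "B = ?h C" using B unfolding pullback_def by blast
    show ?thesis
      unfolding pullback_def by (rule image_eqI[OF _ sym[OF C(1)]]) (simp only: C(2) neg)
  qed
  moreover have "0 \<in> B" if B: "B \<in> pullback m g Q" "uminus ` B = B" for B
  proof -
    obtain C where C: "C \<in> Q" "B = ?h C" using B(1) unfolding pullback_def by blast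
    then have "?h (uminus ` C) = ?h C" using B(2) neg[of C] by (simp only:)
    then have "uminus ` C = C" by (rule inj_onD[OF inj _ sym[OF C(1)] C(1)])
    then have "0 \<in> C" using Q C(1) unfolding signed_partition_def by blast
    then show ?thesis using C g0 by simp
  qed
  ultimately show "signed_partition m (pullback m g Q)"
    unfolding signed_partition_def by blast
qed

lemma separates_pullback:
  assumes "separates s Q" "\<And>x. \<bar>x\<bar> \<le> int s \<Longrightarrow> g x = x"
  shows "separates s (pullback m g Q)"
  using assms unfolding separates_def pullback_def by fastforce

text \<open>
  The composite \<open>f \<circ> g\<close> need not be the identity; it suffices that it moves every point within its
  block. This is what happens when \<open>\<plusminus>r\<close> is collapsed onto \<open>\<plusminus>c\<close> in the same block.
\<close>

lemma pullback_pullback_id: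
  assumes Q: "\<Union>Q = {- int n..int n}"
    and range: "\<And>y. y \<in> {- int n..int n} \<Longrightarrow> g y \<in> {- int m..int m}"
    and fix_blocks: "\<And>B y. B \<in> Q \<Longrightarrow> y \<in> {- int n..int n} \<Longrightarrow> f (g y) \<in> B \<longleftrightarrow> y \<in> B"
  shows "pullback n g (pullback m f Q) = Q"
proof -
  have "{y \<in> {- int n..int n}. g y \<in> {x \<in> {- int m..int m}. f x \<in> B}} = B" if "B \<in> Q" for B
    using that range fix_blocks[OF that] Q by blast
  then show ?thesis unfolding pullback_def by (simp add: image_image)
qed

section \<open>Collapsing one element onto a separated one\<close>

text \<open>
  The odd map \<open>collapse r c\<close> sends \<open>\<plusminus>r\<close> to \<open>\<plusminus>c\<close> and closes the gap by moving the points
  beyond \<open>\<plusminus>r\<close> one step towards 0. The odd map \<open>skip r\<close> is its section that avoids \<open>\<plusminus>r\<close>.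
\<close>

definition collapse :: "int \<Rightarrow> int \<Rightarrow> int \<Rightarrow> int" where
  "collapse r c x = (if \<bar>x\<bar> < r then x else if x = r then c else if x = - r then - c else x - sgn x)"

definition skip :: "int \<Rightarrow> int \<Rightarrow> int" where
  "skip r x = (if \<bar>x\<bar> < r then x else x + sgn x)"

text \<open>
  Pulling back along \<open>collapse r c\<close> inserts \<open>\<plusminus>r\<close> into the blocks of \<open>\<plusminus>c\<close>, and pulling back
  along \<open>skip r\<close> deletes \<open>\<plusminus>r\<close>. Deletion is undone by insertion exactly because \<open>r\<close> and \<open>c\<close>
  were in the same block. Both maps fix \<open>{-(r-1)..r-1}\<close>, so separation is kept in both directions;
  this is also why \<open>c\<close> has to come from that interval.
\<close>

lemma card_signed_partitions_glued:
  assumes r: "1 \<le> r" "r \<le> n" and c: "\<bar>c\<bar> \<le> int (r - 1)"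
  shows "card {Q \<in> signed_partitions n k (r - 1). \<exists>B\<in>Q. int r \<in> B \<and> c \<in> B}
       = card (signed_partitions (n - 1) k (r - 1))" (is "card ?G = _")
proof -
  let ?f = "collapse (int r) c" and ?g = "skip (int r)"
  have f_odd: "?f (- x) = - ?f x" for x using r by (auto simp: collapse_def)
  have g_odd: "?g (- x) = - ?g x" for x by (auto simp: skip_def)
  have f_range: "?f x \<in> {- int (n - 1)..int (n - 1)}" if "x \<in> {- int n..int n}" for x
    using that r c by (auto simp: collapse_def sgn_if)
  have g_range: "?g x \<in> {- int n..int n}" if "x \<in> {- int (n - 1)..int (n - 1)}" for x
    using that r by (auto simp: skip_def sgn_if)
  have fg: "?f (?g x) = x" for x using r by (auto simp: collapse_def skip_def sgn_if)
  have gf: "?g (?f x) = (if x = int r then c else if x = - int r then - c else x)" for x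
    using r c by (auto simp: collapse_def skip_def sgn_if)
  have f_id: "?f x = x" if "\<bar>x\<bar> \<le> int (r - 1)" for x
    using that r by (auto simp: collapse_def)
  have g_id: "?g x = x" if "\<bar>x\<bar> \<le> int (r - 1)" for x
    using that r by (auto simp: skip_def)
  have block_gf: "?g (?f x) \<in> B \<longleftrightarrow> x \<in> B" if Q: "Q \<in> ?G" and B: "B \<in> Q" for Q B x
  proof -
    have part: "partition_on {- int n..int n} Q" and sym: "\<And>B. B \<in> Q \<Longrightarrow> uminus ` B \<in> Q"
      using Q by (auto simp: signed_partitions_def signed_partition_def)
    have rc: "int r \<in> D \<longleftrightarrow> c \<in> D" if "D \<in> Q" for D
      using Q that partition_on_block_unique[OF part] by blast
    \<comment> \<open>The opposite statement comes from applying the same equivalence to the block \<open>-B\<close>.\<close>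
    have "- int r \<in> B \<longleftrightarrow> - c \<in> B"
      using rc[OF sym[OF B]] by (simp add: mem_uminus_image)
    then show ?thesis using rc[OF B] by (simp add: gf)
  qed
  have union: "\<Union>Q = {- int m..int m}" if "Q \<in> signed_partitions m k s" for Q m s
    using that by (simp add: signed_partitions_def signed_partition_def partition_on_def)
  have "bij_betw (pullback (n - 1) ?g) ?G (signed_partitions (n - 1) k (r - 1))"
  proof (rule bij_betwI)
    show "pullback (n - 1) ?g \<in> ?G \<rightarrow> signed_partitions (n - 1) k (r - 1)"
    proof
      fix Q assume Q: "Q \<in> ?G"
      then have sp: "signed_partition n Q" by (simp add: signed_partitions_def)
      have hit: "\<exists>x \<in> {- int (n - 1)..int (n - 1)}. ?g x \<in> B" if B: "B \<in> Q" for B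
      proof -
        obtain x where "x \<in> B" using sp B unfolding signed_partition_def partition_on_def by fastforce
        moreover have "x \<in> {- int n..int n}" using union Q B calculation by blast
        ultimately show ?thesis using block_gf[OF Q B] f_range by blast
      qed
      show "pullback (n - 1) ?g Q \<in> signed_partitions (n - 1) k (r - 1)"
        using signed_partition_pullback[where g = ?g, OF sp g_range g_odd hit]
          separates_pullback[of "r - 1" Q ?g "n - 1"] g_id Q
        by (simp add: signed_partitions_def)
    qed
    show "pullback n ?f \<in> signed_partitions (n - 1) k (r - 1) \<rightarrow> ?G"
    proof
      fix Q assume Q: "Q \<in> signed_partitions (n - 1) k (r - 1)"
      then have sp: "signed_partition (n - 1) Q" by (simp add: signed_partitions_def)
      have hit: "\<exists>x \<in> {- int n..int n}. ?f x \<in> B" if B: "B \<in> Q" for B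
      proof -
        obtain y where "y \<in> B" using sp B unfolding signed_partition_def partition_on_def by fastforce
        moreover have "y \<in> {- int (n - 1)..int (n - 1)}" using union Q B calculation by blast
        ultimately show ?thesis using fg g_range by metis
      qed
      have "pullback n ?f Q \<in> signed_partitions n k (r - 1)"
        using signed_partition_pullback[where g = ?f, OF sp f_range f_odd hit]
          separates_pullback[of "r - 1" Q ?f n] f_id Q
        by (simp add: signed_partitions_def)
      moreover have "\<exists>B \<in> pullback n ?f Q. int r \<in> B \<and> c \<in> B"
      proof -
        have "c \<in> \<Union>Q" using union[OF Q] c r by auto
        then obtain B where B: "B \<in> Q" "c \<in> B" by blast
        have "?f (int r) = c" "?f c = c" using f_id[OF c] r by (auto simp: collapse_def)
        moreover define D where "D = {x \<in> {- int n..int n}. ?f x \<in> B}"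
        ultimately have "int r \<in> D \<and> c \<in> D" using B c r by auto
        moreover have "D \<in> pullback n ?f Q"
          unfolding pullback_def D_def using B(1) by (rule imageI)
        ultimately show ?thesis by (rule bexI)
      qed
      ultimately show "pullback n ?f Q \<in> ?G" by blast
    qed
    show "pullback n ?f (pullback (n - 1) ?g Q) = Q" if Q: "Q \<in> ?G" for Q
    proof (rule pullback_pullback_id[where f = ?g and g = ?f, OF _ f_range block_gf[OF Q]])
      show "\<Union>Q = {- int n..int n}" using Q by (intro union[where s = "r - 1"]) simp
    qed
    show "pullback (n - 1) ?g (pullback n ?f Q) = Q" if Q: "Q \<in> signed_partitions (n - 1) k (r - 1)" for Q
      by (rule pullback_pullback_id[OF union[OF Q] g_range]) (simp_all add: fg)
  qed
  then show ?thesis by (rule bij_betw_same_card)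
qed

section \<open>The recurrence\<close>

text \<open>
  A new coincidence among \<open>-r, \<dots>, r\<close> involves \<open>r\<close> or \<open>-r\<close>. By negation it may be taken to
  involve \<open>r\<close>, and if its partner is \<open>-r\<close>, the block is self-opposite and contains 0, so that
  \<open>c = 0\<close> is a partner with \<open>\<bar>c\<bar> < r\<close>.
\<close>

lemma separates_step:
  assumes Q: "signed_partition n Q" and sep: "separates (r - 1) Q" and r: "1 \<le> r" "r \<le> n"
  shows "separates r Q \<longleftrightarrow> \<not> (\<exists>c. \<bar>c\<bar> \<le> int (r - 1) \<and> (\<exists>B\<in>Q. int r \<in> B \<and> c \<in> B))"
proof
  assume s: "separates r Q"
  show "\<not> (\<exists>c. \<bar>c\<bar> \<le> int (r - 1) \<and> (\<exists>B\<in>Q. int r \<in> B \<and> c \<in> B))"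
  proof clarify
    fix c B assume *: "\<bar>c\<bar> \<le> int (r - 1)" "B \<in> Q" "int r \<in> B" "c \<in> B"
    then have "int r = c" using separatesD[OF s *(2-4)] r by simp
    then show False using * r by auto
  qed
next
  have part: "partition_on {- int n..int n} Q" and sym: "\<And>B. B \<in> Q \<Longrightarrow> uminus ` B \<in> Q"
    using Q by (auto simp: signed_partition_def)
  assume free: "\<not> (\<exists>c. \<bar>c\<bar> \<le> int (r - 1) \<and> (\<exists>B\<in>Q. int r \<in> B \<and> c \<in> B))"
  have pos: "\<not> \<bar>c\<bar> \<le> int (r - 1)" if "B \<in> Q" "int r \<in> B" "c \<in> B" for B c
    using free that by blast
  have neg: "\<not> \<bar>c\<bar> \<le> int (r - 1)" if "B \<in> Q" "- int r \<in> B" "c \<in> B" for B c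
    using pos[OF sym[OF that(1)], of "- c"] that by (simp add: mem_uminus_image)
  have opp: False if B: "B \<in> Q" "int r \<in> B" "- int r \<in> B" for B
  proof -
    have "int r \<in> uminus ` B" using B(3) by (simp add: mem_uminus_image)
    then have "uminus ` B = B"
      using partition_on_block_unique[OF part sym[OF B(1)] B(1), of "int r"] B(2) by simp
    then have "0 \<in> B" using Q B(1) unfolding signed_partition_def by blast
    then show False using pos[OF B(1,2), of 0] by simp
  qed
  have edge: "\<bar>x\<bar> \<le> int (r - 1) \<or> x = int r \<or> x = - int r" if "\<bar>x\<bar> \<le> int r" for x
    using that r by auto
  show "separates r Q"
    unfolding separates_def
  proof (intro ballI impI)
    fix B x y assume B: "B \<in> Q" "x \<in> B" "y \<in> B" and xy: "\<bar>x\<bar> \<le> int r" "\<bar>y\<bar> \<le> int r"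
    show "x = y"
      using edge[OF xy(1)] edge[OF xy(2)] pos[OF B(1)] neg[OF B(1)] opp[OF B(1)] B sep
      unfolding separates_def by blast
  qed
qed

lemma finite_signed_partitions: "finite (signed_partitions n k s)"
proof (rule finite_subset)
  show "signed_partitions n k s \<subseteq> Pow (Pow {- int n..int n})"
    by (auto simp: signed_partitions_def signed_partition_def partition_on_def)
qed simp

text \<open>
  The classes \<open>G c\<close>, where \<open>r\<close> shares its block with \<open>c\<close>, are disjoint because two candidates
  \<open>c \<noteq> d\<close> in the block of \<open>r\<close> would not be separated. There are \<open>2 (r - 1) + 1 = 2r - 1\<close> of them.
\<close>

lemma card_signed_partitions_step:
  assumes r: "1 \<le> r" "r \<le> n"
  shows "card (signed_partitions n k (r - 1))
       = card (signed_partitions n k r) + (2 * r - 1) * card (signed_partitions (n - 1) k (r - 1))"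
proof -
  let ?S = "{- int (r - 1)..int (r - 1)}"
  define G where "G c = {Q \<in> signed_partitions n k (r - 1). \<exists>B\<in>Q. int r \<in> B \<and> c \<in> B}" for c
  have S: "c \<in> ?S \<longleftrightarrow> \<bar>c\<bar> \<le> int (r - 1)" for c by auto
  have sub: "signed_partitions n k r \<subseteq> signed_partitions n k (r - 1)"
    unfolding signed_partitions_def separates_def by force
  have step: "Q \<in> signed_partitions n k r \<longleftrightarrow> \<not> (\<exists>c\<in>?S. Q \<in> G c)"
    if Q: "Q \<in> signed_partitions n k (r - 1)" for Q
  proof -
    have "Q \<in> signed_partitions n k r \<longleftrightarrow> separates r Q"
      using Q by (simp add: signed_partitions_def)
    also have "\<dots> \<longleftrightarrow> \<not> (\<exists>c. \<bar>c\<bar> \<le> int (r - 1) \<and> (\<exists>B\<in>Q. int r \<in> B \<and> c \<in> B))"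
      by (rule separates_step[OF _ _ r]) (use Q in \<open>simp_all add: signed_partitions_def\<close>)
    also have "\<dots> \<longleftrightarrow> \<not> (\<exists>c\<in>?S. Q \<in> G c)"
      unfolding G_def Bex_def[of ?S] S using Q by simp
    finally show ?thesis .
  qed
  have "G c \<subseteq> signed_partitions n k (r - 1)" for c unfolding G_def by blast
  then have split: "signed_partitions n k (r - 1) = signed_partitions n k r \<union> (\<Union>c\<in>?S. G c)"
    and disj: "signed_partitions n k r \<inter> (\<Union>c\<in>?S. G c) = {}"
    using sub step by blast+
  have fin: "finite (G c)" for c unfolding G_def using finite_signed_partitions by simp
  have unique: "c = d" if cd: "c \<in> ?S" "d \<in> ?S" and Q: "Q \<in> G c" "Q \<in> G d" for c d Q
  proof -
    have part: "partition_on {- int n..int n} Q" and sep: "separates (r - 1) Q"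
      using Q by (auto simp: G_def signed_partitions_def signed_partition_def)
    obtain B C where "B \<in> Q" "int r \<in> B" "c \<in> B" "C \<in> Q" "int r \<in> C" "d \<in> C"
      using Q unfolding G_def by blast
    moreover from this have "C = B" using partition_on_block_unique[OF part] by blast
    moreover have "\<bar>c\<bar> \<le> int (r - 1)" "\<bar>d\<bar> \<le> int (r - 1)" using cd by auto
    ultimately show "c = d" using sep unfolding separates_def by blast
  qed
  have "card (\<Union>c\<in>?S. G c) = (\<Sum>c\<in>?S. card (G c))"
    by (rule card_UN_disjoint) (use fin unique in auto)
  also have "\<dots> = (\<Sum>c\<in>?S. card (signed_partitions (n - 1) k (r - 1)))"
    by (rule sum.cong) (use card_signed_partitions_glued[OF r] in \<open>auto simp: G_def\<close>)
  also have "\<dots> = (2 * r - 1) * card (signed_partitions (n - 1) k (r - 1))"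
  proof -
    have "card ?S = 2 * r - 1" using r by simp
    then show ?thesis by (simp only: sum_constant of_nat_id)
  qed
  finally show ?thesis
    unfolding split using disj fin finite_signed_partitions by (simp add: card_Un_disjoint)
qed

theorem proposition3p7:
  fixes n k r :: nat
  assumes "n \<ge> k" and "k \<ge> r" and "r \<ge> 1"
  shows "int (stirling_B n k r) =
    int (stirling_B n k (r - 1)) - (2 * int r - 1) * int (stirling_B (n - 1) k (r - 1))"
proof -
  have r: "1 \<le> r" "r \<le> n" using assms by auto
  have "stirling_B n k (r - 1) = stirling_B n k r + (2 * r - 1) * stirling_B (n - 1) k (r - 1)"
    using card_signed_partitions_step[OF r, of k] r
    by (simp add: stirling_B_eq_card_signed_partitions)
  then show ?thesis using r by (simp add: of_nat_diff)
qed

end
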